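(* Let $(\rho,V)$ be any two-dimensional irreducible complex representation of $\mathcal{LB}_3$ with $\rho(\sigma_1)=A$, $\rho(\sigma_2)=B$, $A\neq B$, $\rho(s_1)=S_1$ and $\rho(s_2)=S_2$. Then $\rho(s_1s_2)=-(\mathrm{Tr}(AB))^{-1}AB$. Moreover, every two-dimensional complex representation $(\rho,V)$ of $\mathcal{B}_3$ with $\rho(\sigma_1)=A\neq B=\rho(\sigma_2)$ can be extended in this way, i.e. to a representation of $\mathcal{LB}_3$ on $V$ with $\rho(s_1s_2)=-(\mathrm{Tr}(AB))^{-1}AB$. The choices for $(S_1,S_2)=(\rho(s_1),\rho(s_2))$ in such an extension are in one-to-one correspondence with $\mathrm{Gr}(V,1)\setminus\{V_\omega,V_{\omega^2}\}$.
   Context: $\mathcal{B}_3=\langle \sigma_1,\sigma_2 : \sigma_1\sigma_2\sigma_1=\sigma_2\sigma_1\sigma_2\rangle$ is the braid group. The three component loop braid group $\mathcal{LB}_3$ is the group generated by $\sigma_1,\sigma_2,s_1,s_2$ with relations $\sigma_1\sigma_2\sigma_1=\sigma_2\sigma_1\sigma_2$; $s_1s_2s_1=s_2s_1s_2$; $s_1^2=s_2^2=1$; $s_1s_2\sigma_1=\sigma_2s_1s_2$; $\sigma_1\sigma_2s_1=s_2\sigma_1\sigma_2$. $\mathrm{Gr}(V,1)$ is the set of one-dimensional linear subspaces of $V$. $\omega$ is a primitive third root of unity, and $V_\lambda$ denotes the $\lambda$-eigenspace of $S=\rho(s_1s_2)$ on $V$. *)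

theory Defs
  imports Complex_Main "HOL-Algebra.Group"
begin

section \<open>Groups given by generators and relations\<close>

text \<open>The letter \<^term>\<open>(g, True)\<close> stands for the generator \<open>g\<close>, the letter
  \<^term>\<open>(g, False)\<close> for its formal inverse. The generating set is the whole type \<open>'g\<close>.\<close>

type_synonym 'g word = "('g \<times> bool) list"

abbreviation letter :: "'g \<Rightarrow> 'g \<times> bool" where
  "letter g \<equiv> (g, True)"

text \<open>A pair \<^term>\<open>(l, r)\<close> in \<open>R\<close> stands for the defining relation \<open>l = r\<close>. Two words are
  equivalent iff they represent the same element of the presented group.\<close>

inductive word_eq :: "('g word \<times> 'g word) set \<Rightarrow> 'g word \<Rightarrow> 'g word \<Rightarrow> bool"
  for R :: "('g word \<times> 'g word) set"
where
  refl: "word_eq R w w"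
| sym: "word_eq R v w \<Longrightarrow> word_eq R w v"
| trans: "word_eq R u v \<Longrightarrow> word_eq R v w \<Longrightarrow> word_eq R u w"
| cancel: "word_eq R (u @ [(g, b), (g, \<not> b)] @ v) (u @ v)"
| rel: "(l, r) \<in> R \<Longrightarrow> word_eq R (u @ l @ v) (u @ r @ v)"

definition word_class :: "('g word \<times> 'g word) set \<Rightarrow> 'g word \<Rightarrow> 'g word set" where
  "word_class R w = {v. word_eq R w v}"

definition presented_group :: "('g word \<times> 'g word) set \<Rightarrow> 'g word set monoid" where
  "presented_group R =
     \<lparr>carrier = range (word_class R),
      mult = (\<lambda>X Y. {w. \<exists>x\<in>X. \<exists>y\<in>Y. word_eq R (x @ y) w}),
      one = word_class R []\<rparr>"

lemma word_eq_ctxt: "word_eq R v w \<Longrightarrow> word_eq R (a @ v @ c) (a @ w @ c)"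
proof (induction rule: word_eq.induct)
  case (cancel u g b v)
  show ?case using word_eq.cancel[of R "a @ u" g b "v @ c"] by simp
next
  case (rel l r u v)
  show ?case using word_eq.rel[OF rel, of "a @ u" "v @ c"] by simp
qed (blast intro: word_eq.intros)+

lemma word_eq_append:
  "word_eq R v v' \<Longrightarrow> word_eq R w w' \<Longrightarrow> word_eq R (v @ w) (v' @ w')"
  using word_eq_ctxt[of R v v' "[]" w] word_eq_ctxt[of R w w' v' "[]"]
  by (auto intro: word_eq.trans)

lemma word_class_eq_iff: "word_class R v = word_class R w \<longleftrightarrow> word_eq R v w"
  unfolding word_class_def by (blast intro: word_eq.intros)

lemma presented_group_mult:
  "word_class R v \<otimes>\<^bsub>presented_group R\<^esub> word_class R w = word_class R (v @ w)"
  unfolding presented_group_def word_class_def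
  by (auto intro: word_eq_append word_eq.intros)

lemma presented_group_relation:
  "(l, r) \<in> R \<Longrightarrow> word_class R l = word_class R r"
  using word_eq.rel[of l r R "[]" "[]"] by (simp add: word_class_eq_iff)

lemma word_eq_left_inverse:
  "word_eq R (rev (map (\<lambda>(g, b). (g, \<not> b)) w) @ w) []"
proof (induction w)
  case Nil
  show ?case by (simp add: word_eq.refl)
next
  case (Cons x w)
  obtain g b where x: "x = (g, b)" by force
  have "word_eq R (rev (map (\<lambda>(g, b). (g, \<not> b)) w) @ [(g, \<not> b), (g, \<not> \<not> b)] @ w)
     (rev (map (\<lambda>(g, b). (g, \<not> b)) w) @ w)"
    by (rule word_eq.cancel)
  with Cons show ?case by (auto simp: x intro: word_eq.trans)
qed

lemma presented_group_is_group: "group (presented_group R)"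
proof (rule groupI)
  fix X Y assume "X \<in> carrier (presented_group R)" "Y \<in> carrier (presented_group R)"
  then obtain v w where "X = word_class R v" "Y = word_class R w"
    by (auto simp: presented_group_def)
  then show "X \<otimes>\<^bsub>presented_group R\<^esub> Y \<in> carrier (presented_group R)"
    unfolding presented_group_mult[of R v w, folded \<open>X = _\<close> \<open>Y = _\<close>]
    by (simp add: presented_group_def)
next
  show "\<one>\<^bsub>presented_group R\<^esub> \<in> carrier (presented_group R)"
    by (simp add: presented_group_def)
next
  fix X Y Z assume "X \<in> carrier (presented_group R)" "Y \<in> carrier (presented_group R)"
    "Z \<in> carrier (presented_group R)"
  then obtain u v w where "X = word_class R u" "Y = word_class R v" "Z = word_class R w"
    by (auto simp: presented_group_def)
  then show "X \<otimes>\<^bsub>presented_group R\<^esub> Y \<otimes>\<^bsub>presented_group R\<^esub> Z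
      = X \<otimes>\<^bsub>presented_group R\<^esub> (Y \<otimes>\<^bsub>presented_group R\<^esub> Z)"
    by (simp add: presented_group_mult)
next
  fix X assume "X \<in> carrier (presented_group R)"
  then obtain w where X: "X = word_class R w" by (auto simp: presented_group_def)
  have one: "\<one>\<^bsub>presented_group R\<^esub> = word_class R []"
    by (simp add: presented_group_def)
  show "\<one>\<^bsub>presented_group R\<^esub> \<otimes>\<^bsub>presented_group R\<^esub> X = X"
    by (simp add: one X presented_group_mult)
  show "\<exists>Y\<in>carrier (presented_group R). Y \<otimes>\<^bsub>presented_group R\<^esub> X = \<one>\<^bsub>presented_group R\<^esub>"
  proof
    show "word_class R (rev (map (\<lambda>(g, b). (g, \<not> b)) w)) \<otimes>\<^bsub>presented_group R\<^esub> X
        = \<one>\<^bsub>presented_group R\<^esub>"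
      by (simp add: one X presented_group_mult word_class_eq_iff word_eq_left_inverse)
  qed (simp add: presented_group_def)
qed


section \<open>The braid group and the loop braid group\<close>

datatype braid_gen = Sigma1 | Sigma2

definition braid_relations :: "(braid_gen word \<times> braid_gen word) set" where
  "braid_relations =
     {(map letter [Sigma1, Sigma2, Sigma1], map letter [Sigma2, Sigma1, Sigma2])}"

definition B3 :: "braid_gen word set monoid" where
  "B3 = presented_group braid_relations"

definition braid_elt :: "braid_gen \<Rightarrow> braid_gen word set" where
  "braid_elt g = word_class braid_relations [letter g]"

datatype loop_gen = LSigma1 | LSigma2 | LS1 | LS2

definition loop_braid_relations :: "(loop_gen word \<times> loop_gen word) set" where
  "loop_braid_relations =
     {(map letter [LSigma1, LSigma2, LSigma1], map letter [LSigma2, LSigma1, LSigma2]),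
      (map letter [LS1, LS2, LS1], map letter [LS2, LS1, LS2]),
      (map letter [LS1, LS1], []),
      (map letter [LS2, LS2], []),
      (map letter [LS1, LS2, LSigma1], map letter [LSigma2, LS1, LS2]),
      (map letter [LSigma1, LSigma2, LS1], map letter [LS2, LSigma1, LSigma2])}"

definition LB3 :: "loop_gen word set monoid" where
  "LB3 = presented_group loop_braid_relations"

definition loop_elt :: "loop_gen \<Rightarrow> loop_gen word set" where
  "loop_elt g = word_class loop_braid_relations [letter g]"


section \<open>Representations on a complex vector space\<close>

text \<open>A complex vector space is a type \<open>'v\<close> with a scalar multiplication \<open>scale\<close> satisfying
  \<^term>\<open>vector_space scale\<close>.\<close>

definition GL :: "(complex \<Rightarrow> 'v::ab_group_add \<Rightarrow> 'v) \<Rightarrow> ('v \<Rightarrow> 'v) monoid" where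
  "GL scale = \<lparr>carrier = {f. Vector_Spaces.linear scale scale f \<and> bij f},
               mult = (\<circ>), one = id\<rparr>"

lemma GL_is_group:
  assumes "vector_space scale"
  shows "group (GL scale)"
proof -
  interpret V: vector_space scale by fact
  show ?thesis
  proof (rule groupI)
    fix f assume "f \<in> carrier (GL scale)"
    then have f: "Vector_Spaces.linear scale scale f" "bij f" by (auto simp: GL_def)
    interpret f: Vector_Spaces.linear scale scale f by (rule f)
    have add: "inv_into UNIV f (x + y) = inv_into UNIV f x + inv_into UNIV f y" for x y
      using f(2) by (metis f.add bij_inv_eq_iff)
    have sc: "inv_into UNIV f (scale c x) = scale c (inv_into UNIV f x)" for c x
      using f(2) by (metis f.scale bij_inv_eq_iff)
    have "Vector_Spaces.linear scale scale (inv_into UNIV f)"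
      by (simp add: Vector_Spaces.linear_iff add sc V.vector_space_axioms)
    then have "inv_into UNIV f \<in> carrier (GL scale)"
      using f by (simp add: GL_def bij_imp_bij_inv)
    moreover have "inv_into UNIV f \<otimes>\<^bsub>GL scale\<^esub> f = \<one>\<^bsub>GL scale\<^esub>"
      using f(2) by (simp add: GL_def bij_is_inj)
    ultimately show "\<exists>g\<in>carrier (GL scale). g \<otimes>\<^bsub>GL scale\<^esub> f = \<one>\<^bsub>GL scale\<^esub>" by blast
  qed (auto simp: GL_def comp_assoc bij_comp V.linear_id intro: Vector_Spaces.linear_compose)
qed

definition group_rep ::
  "(complex \<Rightarrow> 'v::ab_group_add \<Rightarrow> 'v) \<Rightarrow> ('g, 'm) monoid_scheme \<Rightarrow> ('g \<Rightarrow> 'v \<Rightarrow> 'v) \<Rightarrow> bool" where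
  "group_rep scale G \<rho> \<longleftrightarrow> vector_space scale \<and> \<rho> \<in> hom G (GL scale)"

definition irreducible_rep ::
  "(complex \<Rightarrow> 'v::ab_group_add \<Rightarrow> 'v) \<Rightarrow> ('g, 'm) monoid_scheme \<Rightarrow> ('g \<Rightarrow> 'v \<Rightarrow> 'v) \<Rightarrow> bool" where
  "irreducible_rep scale G \<rho> \<longleftrightarrow>
     group_rep scale G \<rho> \<and> (UNIV :: 'v set) \<noteq> {0} \<and>
     (\<forall>W. module.subspace scale W \<and> (\<forall>g\<in>carrier G. \<rho> g ` W \<subseteq> W) \<longrightarrow> W = {0} \<or> W = UNIV)"

definition is_basis :: "(complex \<Rightarrow> 'v::ab_group_add \<Rightarrow> 'v) \<Rightarrow> 'v set \<Rightarrow> bool" where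
  "is_basis scale B \<longleftrightarrow> \<not> module.dependent scale B \<and> module.span scale B = UNIV"

text \<open>The sum of the diagonal matrix entries with respect to some basis; for a linear
  endomorphism of a finite-dimensional space the choice of the basis is irrelevant, see
  \<open>lin_trace_eq\<close> below.\<close>

definition lin_trace :: "(complex \<Rightarrow> 'v::ab_group_add \<Rightarrow> 'v) \<Rightarrow> ('v \<Rightarrow> 'v) \<Rightarrow> complex" where
  "lin_trace scale f =
     (let B = (SOME B. is_basis scale B)
      in \<Sum>b\<in>B. module.representation scale B (f b) b)"

lemma trace_sum_basis_independent:
  assumes "Vector_Spaces.linear scale scale f"
    and B: "is_basis scale B" "finite B" and C: "is_basis scale C" "finite C"
  shows "(\<Sum>b\<in>B. module.representation scale B (f b) b)
       = (\<Sum>c\<in>C. module.representation scale C (f c) c)"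
proof -
  interpret V: vector_space scale
    using assms(1) by (simp add: Vector_Spaces.linear_iff)
  interpret f: Vector_Spaces.linear scale scale f by fact
  have iB: "V.independent B" "V.span B = UNIV" and iC: "V.independent C" "V.span C = UNIV"
    using B C by (auto simp: is_basis_def)
  let ?r = "V.representation"
  have expand: "?r D (f v) d = (\<Sum>e\<in>E. ?r E v e * ?r D (f e) d)"
    if "V.independent D" "V.span D = UNIV" "V.independent E" "V.span E = UNIV" "finite E"
    for D E v d
  proof -
    have "v = (\<Sum>e\<in>E. scale (?r E v e) e)"
      using V.sum_representation_eq[of E v E] that by simp
    then have "?r D (f v) d = ?r D (f (\<Sum>e\<in>E. scale (?r E v e) e)) d" by (rule arg_cong)
    then show ?thesis
      by (simp add: f.sum f.scale V.representation_sum V.representation_scale that)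
  qed
  have chg: "?r B w b = (\<Sum>c\<in>C. ?r C w c * ?r B c b)" for w b
  proof -
    have "w = (\<Sum>c\<in>C. scale (?r C w c) c)"
      using V.sum_representation_eq[of C w C] iC C by simp
    then have "?r B w b = ?r B (\<Sum>c\<in>C. scale (?r C w c) c) b" by (rule arg_cong)
    then show ?thesis by (simp add: V.representation_sum V.representation_scale iB)
  qed
  have "(\<Sum>b\<in>B. ?r B (f b) b) = (\<Sum>b\<in>B. \<Sum>c\<in>C. ?r C (f b) c * ?r B c b)"
    by (intro sum.cong HOL.refl chg)
  also have "\<dots> = (\<Sum>c\<in>C. \<Sum>b\<in>B. ?r B c b * ?r C (f b) c)"
    by (subst sum.swap) (simp only: mult.commute)
  also have "\<dots> = (\<Sum>c\<in>C. ?r C (f c) c)"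
    by (intro sum.cong HOL.refl expand[OF iC iB B(2), symmetric])
  finally show ?thesis .
qed

lemma lin_trace_eq:
  assumes f: "Vector_Spaces.linear scale scale f" and B: "is_basis scale B" "finite B"
  shows "lin_trace scale f = (\<Sum>b\<in>B. module.representation scale B (f b) b)"
proof -
  interpret V: vector_space scale
    using assms(1) by (simp add: Vector_Spaces.linear_iff)
  interpret f: Vector_Spaces.linear scale scale f by fact
  define C where "C = (SOME C. is_basis scale C)"
  have C: "is_basis scale C" unfolding C_def by (rule someI, rule B)
  have "finite C"
    using V.independent_span_bound[of B C] B C by (auto simp: is_basis_def)
  then show ?thesis
    using trace_sum_basis_independent[OF f C _ B] by (simp add: lin_trace_def C_def Let_def)
qed

definition eigenspace :: "(complex \<Rightarrow> 'v \<Rightarrow> 'v) \<Rightarrow> ('v \<Rightarrow> 'v) \<Rightarrow> complex \<Rightarrow> 'v set" where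
  "eigenspace scale f c = {v. f v = scale c v}"

definition Gr :: "(complex \<Rightarrow> 'v::ab_group_add \<Rightarrow> 'v) \<Rightarrow> nat \<Rightarrow> 'v set set" where
  "Gr scale k = {W. module.subspace scale W \<and> vector_space.dim scale W = k}"

definition primitive_root_of_unity :: "nat \<Rightarrow> complex \<Rightarrow> bool" where
  "primitive_root_of_unity n z \<longleftrightarrow> 0 < n \<and> z ^ n = 1 \<and> (\<forall>k. 0 < k \<and> k < n \<longrightarrow> z ^ k \<noteq> 1)"

text \<open>The endomorphism \<open>- (Tr (AB))\<^sup>-\<^sup>1 AB\<close>. If \<open>Tr (AB) = 0\<close> then this is the zero map, which
  is not invertible on a nonzero space, so an equation \<open>\<rho> g = normalized_product scale A B\<close> for
  a representation \<open>\<rho>\<close> includes the assertion \<open>Tr (AB) \<noteq> 0\<close>.\<close>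

definition normalized_product ::
  "(complex \<Rightarrow> 'v::ab_group_add \<Rightarrow> 'v) \<Rightarrow> ('v \<Rightarrow> 'v) \<Rightarrow> ('v \<Rightarrow> 'v) \<Rightarrow> 'v \<Rightarrow> 'v" where
  "normalized_product scale A B =
     (\<lambda>v. scale (- inverse (lin_trace scale (A \<circ> B))) ((A \<circ> B) v))"

text \<open>A representation of \<open>B3\<close> is determined by its values on the generators, so the second and
  third conjunct say that \<open>\<rho>\<close> is the pullback of \<open>\<rho>'\<close> along the canonical map \<open>B3 \<rightarrow> LB3\<close>.\<close>

definition loop_extension ::
  "(complex \<Rightarrow> 'v::ab_group_add \<Rightarrow> 'v) \<Rightarrow> (braid_gen word set \<Rightarrow> 'v \<Rightarrow> 'v)
     \<Rightarrow> (loop_gen word set \<Rightarrow> 'v \<Rightarrow> 'v) \<Rightarrow> bool" where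
  "loop_extension scale \<rho> \<rho>' \<longleftrightarrow>
     group_rep scale LB3 \<rho>' \<and>
     \<rho>' (loop_elt LSigma1) = \<rho> (braid_elt Sigma1) \<and>
     \<rho>' (loop_elt LSigma2) = \<rho> (braid_elt Sigma2) \<and>
     \<rho>' (loop_elt LS1 \<otimes>\<^bsub>LB3\<^esub> loop_elt LS2)
       = normalized_product scale (\<rho> (braid_elt Sigma1)) (\<rho> (braid_elt Sigma2))"

end

theory Submission
  imports Defs
begin

text \<open>If \<open>ABA = BAB\<close> with \<open>A\<close>, \<open>B\<close> invertible, then \<open>AB\<close> conjugates \<open>A\<close> to \<open>B\<close>, so \<open>A\<close> and \<open>B\<close> have
  the same trace and determinant \<open>d\<close>; the Cayley-Hamilton theorem turns the braid relation into
  \<open>(Tr (AB) - d)(A - B) = 0\<close>. Hence \<open>Tr (AB) = d \<noteq> 0\<close> whenever \<open>A \<noteq> B\<close>, and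
  \<open>T = - (Tr (AB))\<^sup>-\<^sup>1 AB\<close> has trace \<open>-1\<close> and determinant \<open>1\<close>, i.e. eigenvalues \<open>\<omega>\<close>, \<open>\<omega>\<^sup>2\<close>.

  In a representation of the loop braid group \<open>S\<^sub>1\<close> is a nonscalar involution, and in an eigenbasis
  of \<open>S\<^sub>1\<close> the relations \<open>T S\<^sub>1 = S\<^sub>2 T\<close> and \<open>S\<^sub>1 S\<^sub>2 S\<^sub>1 = S\<^sub>2 S\<^sub>1 S\<^sub>2\<close> force \<open>S\<^sub>1 S\<^sub>2 = T\<close>. Conversely,
  extending a representation of the braid group amounts to writing \<open>T = S\<^sub>1 S\<^sub>2\<close> as a product of two
  involutions; in an eigenbasis of \<open>T\<close> this means that \<open>S\<^sub>1\<close> is antidiagonal with entries \<open>b\<close>, \<open>1/b\<close>,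
  and its fixed line is spanned by \<open>(b, 1)\<close>.\<close>


section \<open>Homomorphisms out of presented groups\<close>

primrec word_eval :: "('a, 'm) monoid_scheme \<Rightarrow> ('g \<Rightarrow> 'a) \<Rightarrow> 'g word \<Rightarrow> 'a" where
  "word_eval H \<phi> [] = \<one>\<^bsub>H\<^esub>"
| "word_eval H \<phi> (x # w) =
     (if snd x then \<phi> (fst x) else inv\<^bsub>H\<^esub> \<phi> (fst x)) \<otimes>\<^bsub>H\<^esub> word_eval H \<phi> w"

context group begin

lemma word_eval_closed:
  assumes "range \<phi> \<subseteq> carrier G"
  shows "word_eval G \<phi> w \<in> carrier G"
  using assms by (induction w) auto

lemma word_eval_append:
  assumes "range \<phi> \<subseteq> carrier G"
  shows "word_eval G \<phi> (v @ w) = word_eval G \<phi> v \<otimes> word_eval G \<phi> w"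
  using assms by (induction v) (auto simp: word_eval_closed m_assoc range_subsetD)

text \<open>A cancelling pair evaluates to an element times its inverse, and a defining relation
  holds by hypothesis, so each step of \<open>word_eq\<close> preserves the value. Evaluation thus
  descends to word classes.\<close>

lemma word_eval_cong:
  assumes \<phi>: "range \<phi> \<subseteq> carrier G"
    and R: "\<And>l r. (l, r) \<in> R \<Longrightarrow> word_eval G \<phi> l = word_eval G \<phi> r"
    and "word_eq R v w"
  shows "word_eval G \<phi> v = word_eval G \<phi> w"
  using assms(3)
proof (induction rule: word_eq.induct)
  case (cancel u g b v)
  have "\<phi> g \<in> carrier G" using \<phi> by blast
  then show ?case
    by (cases b) (simp_all add: word_eval_append[OF \<phi>] word_eval_closed[OF \<phi>] m_assoc[symmetric])
qed (simp_all add: word_eval_append[OF \<phi>] R)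

text \<open>Von Dyck's theorem: an assignment of the generators that satisfies the defining
  relations extends to a homomorphism.\<close>

lemma presented_group_hom_exists:
  assumes \<phi>: "range \<phi> \<subseteq> carrier G"
    and R: "\<And>l r. (l, r) \<in> R \<Longrightarrow> word_eval G \<phi> l = word_eval G \<phi> r"
  obtains h where "h \<in> hom (presented_group R) G"
    and "\<And>g. h (word_class R [letter g]) = \<phi> g"
proof
  \<comment> \<open>A representative of \<open>X\<close> is picked arbitrarily;
    \<open>word_eval_cong\<close> makes the choice immaterial.\<close>
  define h where "h X = word_eval G \<phi> (SOME w. X = word_class R w)" for X
  have h: "h (word_class R w) = word_eval G \<phi> w" for w
  proof -
    have "word_class R w = word_class R (SOME v. word_class R w = word_class R v)"
      by (rule someI) (rule HOL.refl)
    then have "word_eq R w (SOME v. word_class R w = word_class R v)"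
      by (simp only: word_class_eq_iff)
    then show ?thesis
      unfolding h_def using word_eval_cong[OF \<phi> R] by metis
  qed
  show "h \<in> hom (presented_group R) G"
  proof (rule homI)
    fix X Y assume "X \<in> carrier (presented_group R)" "Y \<in> carrier (presented_group R)"
    then obtain v w where "X = word_class R v" "Y = word_class R w"
      by (auto simp: presented_group_def)
    then show "h (X \<otimes>\<^bsub>presented_group R\<^esub> Y) = h X \<otimes> h Y"
      by (simp add: presented_group_mult h word_eval_append[OF \<phi>])
  qed (auto simp: presented_group_def h word_eval_closed[OF \<phi>])
  show "h (word_class R [letter g]) = \<phi> g" for g
    using \<phi> by (simp add: h range_subsetD)
qed

text \<open>A homomorphism is determined by its values on the generators; the induction splits off
  the first letter of the word.\<close>

lemma hom_word_class:
  assumes h: "h \<in> hom (presented_group R) G"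
  shows "h (word_class R w) = word_eval G (\<lambda>g. h (word_class R [letter g])) w"
proof (induction w)
  interpret P: group "presented_group R" by (rule presented_group_is_group)
  interpret group_hom "presented_group R" G h
    by (simp add: group_hom_def group_hom_axioms_def h P.group_axioms group_axioms)
  have carr: "word_class R w \<in> carrier (presented_group R)" for w
    by (simp add: presented_group_def)
  have one: "\<one>\<^bsub>presented_group R\<^esub> = word_class R []"
    by (simp add: presented_group_def)
  { case Nil
    show ?case using hom_one by (simp add: one)
  next
    case (Cons x w)
    obtain g b where x: "x = (g, b)" by force
    \<comment> \<open>One free cancellation identifies the class of a formal inverse letter with the
      inverse in the group.\<close>
    have "word_class R [(g, False)] = inv\<^bsub>presented_group R\<^esub> word_class R [letter g]"
      using word_eq.cancel[of R "[]" g False "[]"]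
      by (intro P.inv_equality[symmetric])
        (simp_all add: carr one presented_group_mult word_class_eq_iff)
    then have "h (word_class R [x]) = (if b then h (word_class R [letter g])
        else inv h (word_class R [letter g]))"
      by (simp add: x carr)
    moreover have "h (word_class R (x # w)) = h (word_class R [x]) \<otimes> h (word_class R w)"
      using hom_mult[OF carr carr, of "[x]" w] by (simp add: presented_group_mult)
    ultimately show ?case by (simp add: Cons x) }
qed

lemma hom_presented_group_relation:
  assumes "h \<in> hom (presented_group R) G" "(l, r) \<in> R"
  shows "word_eval G (\<lambda>g. h (word_class R [letter g])) l
    = word_eval G (\<lambda>g. h (word_class R [letter g])) r"
  using presented_group_relation[OF assms(2)] by (simp flip: hom_word_class[OF assms(1)])

end


section \<open>Linear algebra in the plane\<close>

lemma GL_simps [simp]: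
  "f \<otimes>\<^bsub>GL scale\<^esub> g = f \<circ> g" "\<one>\<^bsub>GL scale\<^esub> = id"
  "f \<in> carrier (GL scale) \<longleftrightarrow> Vector_Spaces.linear scale scale f \<and> bij f"
  by (auto simp: GL_def)

text \<open>Here \<open>a b c d\<close> and \<open>p q r s\<close> are the entries of A and B by
  rows, \<open>m1\<close> to \<open>m4\<close> those of AB, and \<open>eqs\<close> is the braid
  relation read as (AB)A = B(AB).\<close>

lemma braid_trace_det:
  fixes a b c d p q r s :: complex
  assumes A: "a * d - b * c \<noteq> 0" and B: "p * s - q * r \<noteq> 0"
    and m: "m1 = a * p + b * r" "m2 = a * q + b * s" "m3 = c * p + d * r" "m4 = c * q + d * s"
    and eqs: "m1 * a + m2 * c = p * m1 + q * m3" "m1 * b + m2 * d = p * m2 + q * m4"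
     "m3 * a + m4 * c = r * m1 + s * m3" "m3 * b + m4 * d = r * m2 + s * m4"
    and ne: "\<not> (a = p \<and> b = q \<and> c = r \<and> d = s)"
  shows "m1 + m4 = a * d - b * c" "m1 + m4 = p * s - q * r"
proof -
  have detm: "m1 * m4 - m2 * m3 = (a * d - b * c) * (p * s - q * r)"
    unfolding m by algebra
  then have detm0: "m1 * m4 - m2 * m3 \<noteq> 0" using A B by simp
  \<comment> \<open>AB conjugates A to B. The nonzero factor det (AB) stands in for the inverse of
    AB, both here and for the trace below.\<close>
  have "(m1 * m4 - m2 * m3) * (a * d - b * c) = (m1 * m4 - m2 * m3) * (p * s - q * r)"
    using eqs by algebra
  with detm0 have det: "a * d - b * c = p * s - q * r" by simp
  have "(m1 * m4 - m2 * m3) * (a + d) = (m1 * m4 - m2 * m3) * (p + s)"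
    using eqs by algebra
  with detm0 have tr: "a + d = p + s" by simp
  \<comment> \<open>Cayley-Hamilton gives ABA = Tr(AB) A - det A (Tr B - B), and likewise with A and
    B exchanged. With equal traces and determinants, ABA - BAB becomes (Tr(AB) - det A)(A -
    B).\<close>
  have k: "(m1 + m4 - (a * d - b * c)) * (a - p) = 0"
    "(m1 + m4 - (a * d - b * c)) * (b - q) = 0"
    "(m1 + m4 - (a * d - b * c)) * (c - r) = 0"
    "(m1 + m4 - (a * d - b * c)) * (d - s) = 0"
    using eqs det tr unfolding m by algebra+
  then show "m1 + m4 = a * d - b * c" using ne by auto
  with det show "m1 + m4 = p * s - q * r" by simp
qed

text \<open>The basis is a parameter because the locale is interpreted again with eigenbases of
  different maps. Without \<open>distinct\<close> the set \<open>{e1, e2}\<close> could be a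
  singleton.\<close>

locale plane = vector_space scale
  for scale :: "complex \<Rightarrow> 'v::ab_group_add \<Rightarrow> 'v" +
  fixes e1 e2 :: 'v
  assumes distinct: "e1 \<noteq> e2"
    and indep: "independent {e1, e2}"
    and span: "span {e1, e2} = UNIV"
begin

section \<open>Coordinates and matrices with respect to the chosen basis\<close>

definition vec :: "complex \<Rightarrow> complex \<Rightarrow> 'v" where
  "vec x y = scale x e1 + scale y e2"

definition X :: "'v \<Rightarrow> complex" where "X v = representation {e1, e2} v e1"

definition Y :: "'v \<Rightarrow> complex" where "Y v = representation {e1, e2} v e2"

definition op :: "complex \<Rightarrow> complex \<Rightarrow> complex \<Rightarrow> complex \<Rightarrow> 'v \<Rightarrow> 'v" where
  "op a b c d v = vec (a * X v + b * Y v) (c * X v + d * Y v)"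

lemma vec_X_Y [simp]: "vec (X v) (Y v) = v"
  using sum_representation_eq[OF indep, of v "{e1, e2}"] distinct span
  by (simp add: vec_def X_def Y_def)

lemma representation_e:
  "representation {e1, e2} e1 = (\<lambda>b. if b = e1 then 1 else 0)"
  "representation {e1, e2} e2 = (\<lambda>b. if b = e2 then 1 else 0)"
  using representation_basis[OF indep] by auto

lemma X_vec [simp]: "X (vec x y) = x"
  and Y_vec [simp]: "Y (vec x y) = y"
  using distinct
  by (auto simp: X_def Y_def vec_def representation_add representation_scale indep span
      representation_e)

lemma vec_eq_iff: "v = w \<longleftrightarrow> X v = X w \<and> Y v = Y w"
  by (metis vec_X_Y)

lemma X_linear [simp]: "X (v + w) = X v + X w" "X (scale k v) = k * X v" "X (- v) = - X v"
  and Y_linear [simp]: "Y (v + w) = Y v + Y w" "Y (scale k v) = k * Y v" "Y (- v) = - Y v"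
  by (simp_all add: X_def Y_def representation_add representation_scale representation_neg indep span)

lemma X_Y_0 [simp]: "X 0 = 0" "Y 0 = 0"
  by (simp_all add: X_def Y_def representation_zero)

lemma vec_1_0: "vec 1 0 = e1" and vec_0_1: "vec 0 1 = e2"
  by (simp_all add: vec_def)

lemma X_Y_basis [simp]: "X e1 = 1" "Y e1 = 0" "X e2 = 0" "Y e2 = 1"
  using X_vec[of 1 0] Y_vec[of 1 0] X_vec[of 0 1] Y_vec[of 0 1]
  by (simp_all only: vec_1_0 vec_0_1)

lemma X_Y_op [simp]: "X (op a b c d v) = a * X v + b * Y v" "Y (op a b c d v) = c * X v + d * Y v"
  by (simp_all add: op_def)

lemma op_eq_iff: "op a b c d = op a' b' c' d' \<longleftrightarrow> a = a' \<and> b = b' \<and> c = c' \<and> d = d'"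
proof
  assume "op a b c d = op a' b' c' d'"
  then have "op a b c d (vec 1 0) = op a' b' c' d' (vec 1 0)"
    "op a b c d (vec 0 1) = op a' b' c' d' (vec 0 1)" by simp_all
  then show "a = a' \<and> b = b' \<and> c = c' \<and> d = d'"
    by (simp add: vec_eq_iff)
qed simp

lemma op_comp: "op a b c d \<circ> op a' b' c' d'
    = op (a * a' + b * c') (a * b' + b * d') (c * a' + d * c') (c * b' + d * d')"
  by (rule ext) (simp add: vec_eq_iff algebra_simps)

lemma id_op: "id = op 1 0 0 1"
  by (rule ext) (simp add: vec_eq_iff)

lemma scale_op: "(\<lambda>v. scale k (op a b c d v)) = op (k * a) (k * b) (k * c) (k * d)"
  by (rule ext) (simp add: vec_eq_iff algebra_simps)

lemma linear_op: "Vector_Spaces.linear scale scale (op a b c d)"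
  by (simp add: Vector_Spaces.linear_iff vector_space_axioms vec_eq_iff algebra_simps)

lemma linear_eq_op:
  assumes "Vector_Spaces.linear scale scale f"
  obtains a b c d where "f = op a b c d"
proof
  interpret f: Vector_Spaces.linear scale scale f by fact
  show "f = op (X (f e1)) (X (f e2)) (Y (f e1)) (Y (f e2))"
  proof
    fix v
    have "f v = f (scale (X v) e1 + scale (Y v) e2)"
      using vec_X_Y[of v] by (simp add: vec_def)
    then show "f v = op (X (f e1)) (X (f e2)) (Y (f e1)) (Y (f e2)) v"
      by (simp add: f.add f.scale vec_eq_iff mult.commute)
  qed
qed

text \<open>For a bijective map the group \<open>GL\<close> supplies a linear inverse, and the two
  determinants multiply to 1. Conversely, the adjugate divided by the determinant is an
  inverse.\<close>

lemma bij_op_iff: "bij (op a b c d) \<longleftrightarrow> a * d - b * c \<noteq> 0"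
proof
  assume bij: "bij (op a b c d)"
  interpret GL: group "GL scale" by (rule GL_is_group) (rule vector_space_axioms)
  have op: "op a b c d \<in> carrier (GL scale)" using bij by (simp add: linear_op)
  then have inv: "inv\<^bsub>GL scale\<^esub> op a b c d \<in> carrier (GL scale)" by (rule GL.inv_closed)
  then obtain a' b' c' d' where inv_eq: "inv\<^bsub>GL scale\<^esub> op a b c d = op a' b' c' d'"
    by (auto elim: linear_eq_op)
  have "op a b c d \<circ> op a' b' c' d' = id"
    using GL.r_inv[OF op] by (simp add: inv_eq)
  then have "(a * d - b * c) * (a' * d' - b' * c') = 1"
    by (simp add: op_comp id_op op_eq_iff) algebra
  then show "a * d - b * c \<noteq> 0" by auto
next
  assume det: "a * d - b * c \<noteq> 0"
  define k where "k = inverse (a * d - b * c)"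
  have k: "k * (a * d - b * c) = 1" using det by (simp add: k_def)
  have "op a b c d \<circ> op (k * d) (- k * b) (- k * c) (k * a) = id"
    "op (k * d) (- k * b) (- k * c) (k * a) \<circ> op a b c d = id"
    using k by (simp_all add: op_comp id_op op_eq_iff algebra_simps)
  then show "bij (op a b c d)" by (rule o_bij[rotated])
qed

lemma lin_trace_op: "lin_trace scale (op a b c d) = a + d"
proof -
  have "is_basis scale {e1, e2}" by (simp add: is_basis_def indep span)
  then have "lin_trace scale (op a b c d)
      = (\<Sum>e\<in>{e1, e2}. representation {e1, e2} (op a b c d e) e)"
    by (intro lin_trace_eq linear_op) auto
  also have "\<dots> = X (op a b c d e1) + Y (op a b c d e2)"
    using distinct by (simp add: X_def Y_def)
  also have "\<dots> = a + d"
    by simp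
  finally show ?thesis .
qed

text \<open>A line is spanned by some nonzero \<open>vec x y\<close>, and \<open>v\<close> lies on
  it iff the determinant of the two vectors vanishes.\<close>

lemma line_iff: "W \<in> Gr scale 1 \<longleftrightarrow> (\<exists>x y. (x, y) \<noteq> (0, 0) \<and> W = {v. y * X v = x * Y v})"
proof -
  have eq: "span {v} = {w. Y v * X w = X v * Y w}" if "v \<noteq> 0" for v
  proof (intro Set.set_eqI iffI)
    fix w assume "w \<in> span {v}"
    then obtain k where "w = scale k v" by (auto simp: span_singleton)
    then show "w \<in> {w. Y v * X w = X v * Y w}" by simp
  next
    fix w assume w: "w \<in> {w. Y v * X w = X v * Y w}"
    \<comment> \<open>The factor is read off a coordinate in which \<open>v\<close> does not
      vanish.\<close>
    have "w = scale (if X v = 0 then Y w / Y v else X w / X v) v"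
      using w that by (auto simp: vec_eq_iff field_simps)
    then show "w \<in> span {v}" unfolding span_singleton by blast
  qed
  have "W \<in> Gr scale 1 \<longleftrightarrow> (\<exists>v. v \<noteq> 0 \<and> W = span {v})"
  proof
    assume "W \<in> Gr scale 1"
    then have W: "subspace W" "dim W = 1" by (auto simp: Gr_def)
    obtain B where B: "B \<subseteq> W" "independent B" "W \<subseteq> span B" "card B = dim W"
      by (rule basis_exists)
    then obtain v where "B = {v}" using W by (auto simp: card_1_singleton_iff)
    then show "\<exists>v. v \<noteq> 0 \<and> W = span {v}"
      using B W span_minimal[of "{v}" W] by (intro exI[of _ v]) auto
  next
    assume "\<exists>v. v \<noteq> 0 \<and> W = span {v}"
    then obtain v where "v \<noteq> 0" "W = span {v}" by blast
    then show "W \<in> Gr scale 1"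
      using dim_span_eq_card_independent[of "{v}"] by (simp add: Gr_def)
  qed
  also have "\<dots> \<longleftrightarrow> (\<exists>x y. (x, y) \<noteq> (0, 0) \<and> W = {v. y * X v = x * Y v})"
  proof
    assume "\<exists>v. v \<noteq> 0 \<and> W = span {v}"
    then obtain v where v: "v \<noteq> 0" "W = span {v}" by blast
    then have "(X v, Y v) \<noteq> (0, 0)" by (auto simp: vec_eq_iff)
    then show "\<exists>x y. (x, y) \<noteq> (0, 0) \<and> W = {v. y * X v = x * Y v}"
      using eq v by blast
  next
    assume "\<exists>x y. (x, y) \<noteq> (0, 0) \<and> W = {v. y * X v = x * Y v}"
    then obtain x y where xy: "(x, y) \<noteq> (0, 0)" "W = {v. y * X v = x * Y v}" by blast
    then have "vec x y \<noteq> 0" by (auto simp: vec_eq_iff)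
    then show "\<exists>v. v \<noteq> 0 \<and> W = span {v}"
      using eq[of "vec x y"] xy by auto
  qed
  finally show ?thesis .
qed


section \<open>Trace, determinant and eigenbases of endomorphisms of the plane\<close>

lemma normalized_product_op:
  assumes A: "Vector_Spaces.linear scale scale A" "bij A"
    and B: "Vector_Spaces.linear scale scale B" "bij B"
    and braid: "A \<circ> B \<circ> A = B \<circ> A \<circ> B" and ne: "A \<noteq> B"
  obtains a b c d where "normalized_product scale A B = op a b c d" "a + d = -1" "a * d - b * c = 1"
    "lin_trace scale (A \<circ> B) \<noteq> 0"
proof -
  obtain a b c d where A_op: "A = op a b c d" using A(1) by (rule linear_eq_op)
  obtain p q r s where B_op: "B = op p q r s" using B(1) by (rule linear_eq_op)
  define m1 m2 m3 m4 where m: "m1 = a * p + b * r" "m2 = a * q + b * s"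
    "m3 = c * p + d * r" "m4 = c * q + d * s"
  have AB: "A \<circ> B = op m1 m2 m3 m4"
    by (simp add: A_op B_op op_comp m)
  have eqs: "op m1 m2 m3 m4 \<circ> A = B \<circ> op m1 m2 m3 m4"
    using braid by (simp add: comp_assoc flip: AB)
  have detA: "a * d - b * c \<noteq> 0" and detB: "p * s - q * r \<noteq> 0"
    using A(2) B(2) by (simp_all add: A_op B_op bij_op_iff)
  have "\<not> (a = p \<and> b = q \<and> c = r \<and> d = s)"
    using ne by (auto simp: A_op B_op)
  then have tr: "m1 + m4 = a * d - b * c" "m1 + m4 = p * s - q * r"
    using braid_trace_det[OF detA detB m] eqs
    by (simp_all add: A_op B_op op_comp op_eq_iff)
  define k where "k = - inverse (m1 + m4)"
  have k: "k * (m1 + m4) = -1" using tr(1) detA by (simp add: k_def)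
  have S: "normalized_product scale A B = op (k * m1) (k * m2) (k * m3) (k * m4)"
    by (simp add: normalized_product_def AB lin_trace_op scale_op flip: k_def)
  have "m1 * m4 - m2 * m3 = (a * d - b * c) * (p * s - q * r)"
    unfolding m by algebra
  \<comment> \<open>Both det A and det B equal Tr(AB), so det (AB) is the square of the trace and
    scaling by \<open>k\<close> makes the determinant 1.\<close>
  then have det: "m1 * m4 - m2 * m3 = (m1 + m4) * (m1 + m4)"
    by (simp flip: tr)
  show thesis
  proof (rule that)
    show "normalized_product scale A B = op (k * m1) (k * m2) (k * m3) (k * m4)" by (rule S)
    show "k * m1 + k * m4 = -1" using k by (simp add: algebra_simps)
    show "k * m1 * (k * m4) - k * m2 * (k * m3) = 1" using k det by algebra
    show "lin_trace scale (A \<circ> B) \<noteq> 0" using tr(1) detA by (simp add: AB lin_trace_op)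
  qed
qed

text \<open>The assumption \<open>quad\<close> says (f - \<alpha>)(f - \<beta>) = 0, so f - \<beta>
  maps into the \<alpha>-eigenspace and f - \<alpha> into the \<beta>-eigenspace. Both maps are
  nonzero, hence both eigenvectors exist.\<close>

lemma plane_eigenbasis:
  assumes f: "Vector_Spaces.linear scale scale f"
    and quad: "\<And>v. f (f v) + scale (\<alpha> * \<beta>) v = scale (\<alpha> + \<beta>) (f v)"
    and ne: "\<alpha> \<noteq> \<beta>" "f \<noteq> scale \<alpha>" "f \<noteq> scale \<beta>"
  obtains e1' e2' where "plane scale e1' e2'" "f = plane.op scale e1' e2' \<alpha> 0 0 \<beta>"
proof -
  interpret f: Vector_Spaces.linear scale scale f by fact
  obtain u where u: "f u \<noteq> scale \<beta> u" using ne by auto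
  obtain w where w: "f w \<noteq> scale \<alpha> w" using ne by auto
  define e1' e2' where e': "e1' = f u - scale \<beta> u" "e2' = f w - scale \<alpha> w"
  have f_f: "f (f v) = scale (\<alpha> + \<beta>) (f v) - scale (\<alpha> * \<beta>) v" for v
    using quad[of v] by (simp add: eq_diff_eq)
  have eig: "f e1' = scale \<alpha> e1'" "f e2' = scale \<beta> e2'"
    unfolding e' by (simp_all add: f.diff f.scale f_f algebra_simps)
  have nz: "e1' \<noteq> 0" "e2' \<noteq> 0" using u w by (simp_all add: e')
  \<comment> \<open>A multiple of \<open>e2'\<close> would be an eigenvector for both
    eigenvalues.\<close>
  have not_mult: "e1' \<noteq> scale k e2'" for k
  proof
    assume e: "e1' = scale k e2'"
    then have "scale \<alpha> e1' = scale \<beta> e1'" using eig by (metis f.scale scale_left_commute)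
    then show False using ne(1) nz(1) by simp
  qed
  then have ind: "independent {e1', e2'}" and dist: "e1' \<noteq> e2'"
    using nz not_mult[of 1] by (auto simp: independent_insert span_singleton)
  have "finite_dimensional_vector_space scale {e1, e2}"
    using indep span by unfold_locales auto
  then interpret F: finite_dimensional_vector_space scale "{e1, e2}" .
  \<comment> \<open>The old basis shows that the dimension is 2, so two independent vectors
    span.\<close>
  have "UNIV \<subseteq> span {e1', e2'}"
    using ind dist distinct span F.dimension_def
    by (intro F.card_ge_dim_independent) (auto simp: F.dim_UNIV)
  then interpret P: plane scale e1' e2'
    using ind dist by unfold_locales auto
  show thesis
  proof (rule that)
    show "plane scale e1' e2'" by (rule P.plane_axioms)
    show "f = P.op \<alpha> 0 0 \<beta>"
    proof
      fix v
      have "f v = f (scale (P.X v) e1' + scale (P.Y v) e2')"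
        using P.vec_X_Y[of v] by (simp add: P.vec_def)
      then show "f v = P.op \<alpha> 0 0 \<beta> v"
        by (simp add: f.add f.scale eig P.vec_eq_iff mult.commute)
    qed
  qed
qed

lemma scale_eq_op: "scale k = op k 0 0 k"
  by (rule ext) (simp add: vec_eq_iff)

text \<open>The characteristic polynomial is x^2 + x + 1, whose roots \<omega> and its square are
  distinct.\<close>

lemma order_3_eigenbasis:
  assumes tr: "a + d = -1" and det: "a * d - b * c = 1" and \<omega>: "\<omega>\<^sup>2 + \<omega> + 1 = 0"
  obtains e1' e2' where "plane scale e1' e2'" "op a b c d = plane.op scale e1' e2' \<omega> 0 0 (\<omega>\<^sup>2)"
proof (rule plane_eigenbasis[OF linear_op[of a b c d], of \<omega> "\<omega>\<^sup>2"])
  have sum: "\<omega> + \<omega>\<^sup>2 = -1" and prod: "\<omega> * \<omega>\<^sup>2 = 1"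
    using \<omega> by algebra+
  \<comment> \<open>Cayley-Hamilton entry by entry: the square of the matrix is minus the matrix
    minus the identity.\<close>
  have "a * a + b * c + 1 = - a" "a * b + b * d = - b" "c * a + d * c = - c" "c * b + d * d + 1 = - d"
    using tr det by algebra+
  then have "op a b c d \<circ> op a b c d = op (- a - 1) (- b) (- c) (- d - 1)"
    by (simp add: op_comp op_eq_iff eq_diff_eq)
  then have square: "op a b c d (op a b c d v) = op (- a - 1) (- b) (- c) (- d - 1) v" for v
    by (metis comp_apply)
  then show "op a b c d (op a b c d v) + scale (\<omega> * \<omega>\<^sup>2) v = scale (\<omega> + \<omega>\<^sup>2) (op a b c d v)" for v
    unfolding sum prod square by (simp add: vec_eq_iff algebra_simps)
  show "\<omega> \<noteq> \<omega>\<^sup>2"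
  proof
    assume "\<omega> = \<omega>\<^sup>2"
    then have "(3::complex) = 0" using \<omega> by algebra
    then show False by simp
  qed
  \<comment> \<open>For a scalar \<open>k\<close> the trace gives 2k = -1 and the determinant k^2 =
    1, so (2k)^2 would be both 1 and 4.\<close>
  have "op a b c d \<noteq> scale k" for k
  proof
    assume "op a b c d = scale k"
    then have "a = k" "b = 0" "c = 0" "d = k" by (simp_all add: scale_eq_op op_eq_iff)
    then have "k + k = -1" "k * k = 1" using tr det by simp_all
    moreover have "(k + k) * (k + k) = 4 * (k * k)" by algebra
    ultimately show False by simp
  qed
  then show "op a b c d \<noteq> scale \<omega>" "op a b c d \<noteq> scale (\<omega>\<^sup>2)" by blast+
qed (rule that)

text \<open>The relations between \<open>S1\<close> and \<open>S2\<close> fix the diagonal of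
  \<open>S2\<close> and the product \<open>q * r\<close>. By \<open>conj\<close> the columns of
  \<open>T\<close> are eigenvectors of \<open>S2\<close> for 1 and -1, and trace and determinant of
  \<open>T\<close> then fix their lengths.\<close>

lemma involution_product_op:
  assumes S1: "S1 = op 1 0 0 (-1)" and S2: "Vector_Spaces.linear scale scale S2" "S2 \<circ> S2 = id"
    and braid: "S1 \<circ> S2 \<circ> S1 = S2 \<circ> S1 \<circ> S2" and ne: "S1 \<circ> S2 \<noteq> id"
    and T: "T = op a b c d" "a + d = -1" "a * d - b * c = 1" and conj: "T \<circ> S1 = S2 \<circ> T"
  shows "S1 \<circ> S2 = T"
proof -
  obtain p q r s where S2_op: "S2 = op p q r s" using S2(1) by (rule linear_eq_op)
  have inv: "p * p + q * r = 1" "p * q + q * s = 0" "r * p + s * r = 0" "r * q + s * s = 1"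
    using S2(2) by (simp_all add: S2_op op_comp id_op op_eq_iff)
  have br: "p = p * p - q * r" "- q = p * q - q * s" "- r = r * p - s * r" "s = r * q - s * s"
    using braid by (simp_all add: S1 S2_op op_comp op_eq_iff algebra_simps)
  have cj: "a = p * a + q * c" "- b = p * b + q * d" "c = r * a + s * c" "- d = r * b + s * d"
    using conj by (simp_all add: S1 S2_op T(1) op_comp op_eq_iff)
  have ne': "\<not> (p = 1 \<and> q = 0 \<and> r = 0 \<and> s = -1)"
    using ne by (simp add: S1 S2_op op_comp id_op op_eq_iff) (metis minus_minus neg_equal_0_iff_equal)
  have half: "x = -1/2" if "2 * x + 1 = 0" for x :: complex
  proof -
    have "2 * x = -1" using that by algebra
    then show ?thesis by (simp add: field_simps)
  qed
  \<comment> \<open>The upper left entries give p^2 = 1 - qr from the involution and p^2 = p + qr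
    from the braid relation; these are added.\<close>
  have "(2 * p + 1) * (p - 1) = 0" using inv br by algebra
  \<comment> \<open>As a conjugate of \<open>S1\<close>, the map \<open>S2\<close> has determinant
    -1. With \<open>p = 1\<close> this leads to \<open>S2 = S1\<close>, which \<open>ne\<close>
    excludes.\<close>
  moreover have "p \<noteq> 1"
  proof
    assume p: "p = 1"
    have "(a * d - b * c) * (p * s - q * r) = - (a * d - b * c)" using cj by algebra
    then have "p * s - q * r = -1" using T by simp
    moreover have "q * r = 0" using inv p by algebra
    ultimately have s: "s = -1" using p by simp
    then have "2 * q = - q" "2 * r = - r" using br p by algebra+
    then have "3 * q = 0" "3 * r = 0" by algebra+
    then show False using ne' p s by simp
  qed
  ultimately have p: "p = -1/2" by (intro half) simp
  have "q * r = 1 - p * p" using inv(1) by algebra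
  then have qr: "q * r = 3/4" by (simp add: p)
  then have "q \<noteq> 0" by auto
  moreover have "q * (p + s) = 0" using inv(2) by algebra
  ultimately have s: "s = 1/2" using p by simp
  have bc: "b = -2 * q * d" "c = 2 * r * a"
  proof -
    have "2 * p = -1" "2 * s = 1" by (simp_all add: p s)
    then show "b = -2 * q * d" "c = 2 * r * a" using cj by algebra+
  qed
  have "a * d - b * c = a * d + 4 * (q * r) * (a * d)" by (simp add: bc algebra_simps)
  then have "4 * (a * d) = 1" using T(3) by (simp add: qr)
  \<comment> \<open>Sum -1 and product 1/4 make \<open>a\<close> and \<open>d\<close> a double
    root.\<close>
  then have "(2 * a + 1) * (2 * a + 1) = 0" using T(2) by algebra
  then have "2 * a + 1 = 0" by simp
  then have a: "a = -1/2" by (rule half)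
  have "d = -1 - a" using T(2) by algebra
  with a have d: "d = -1/2" by simp
  show ?thesis by (simp add: S1 S2_op T(1) op_comp op_eq_iff p s a d bc)
qed

end

lemma plane_exists:
  assumes "vector_space scale" and dim: "vector_space.dim scale (UNIV :: 'v set) = 2"
  obtains e1 e2 where "plane (scale :: complex \<Rightarrow> 'v::ab_group_add \<Rightarrow> 'v) e1 e2"
proof -
  interpret vector_space scale by fact
  obtain B where B: "independent B" "UNIV \<subseteq> span B" "card B = 2"
    using dim by (metis basis_exists)
  then obtain e1 e2 where "B = {e1, e2}" "e1 \<noteq> e2" by (auto simp: card_2_iff)
  with B have "plane scale e1 e2" by unfold_locales auto
  then show thesis by (rule that)
qed


section \<open>Representations and their extensions\<close>

lemma B3_rep_braid:
  assumes "group_rep scale B3 \<rho>"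
  defines "A \<equiv> \<rho> (braid_elt Sigma1)" and "B \<equiv> \<rho> (braid_elt Sigma2)"
  shows "A \<in> carrier (GL scale)" "B \<in> carrier (GL scale)" "A \<circ> B \<circ> A = B \<circ> A \<circ> B"
proof -
  have vs: "vector_space scale" and h: "\<rho> \<in> hom B3 (GL scale)"
    using assms(1) by (auto simp: group_rep_def)
  interpret GL: group "GL scale" using vs by (rule GL_is_group)
  have carr: "braid_elt g \<in> carrier B3" for g
    by (simp add: braid_elt_def B3_def presented_group_def)
  show "A \<in> carrier (GL scale)" "B \<in> carrier (GL scale)"
    unfolding A_def B_def using h carr by (blast dest: hom_in_carrier)+
  have "(map letter [Sigma1, Sigma2, Sigma1], map letter [Sigma2, Sigma1, Sigma2]) \<in> braid_relations"
    by (simp add: braid_relations_def)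
  then show "A \<circ> B \<circ> A = B \<circ> A \<circ> B"
    using GL.hom_presented_group_relation[OF h[unfolded B3_def], of
        "map letter [Sigma1, Sigma2, Sigma1]" "map letter [Sigma2, Sigma1, Sigma2]"]
    by (simp add: A_def B_def comp_assoc flip: braid_elt_def)
qed

lemma LB3_rep_relations:
  assumes "group_rep scale LB3 \<rho>"
  defines "A \<equiv> \<rho> (loop_elt LSigma1)" and "B \<equiv> \<rho> (loop_elt LSigma2)"
    and "S1 \<equiv> \<rho> (loop_elt LS1)" and "S2 \<equiv> \<rho> (loop_elt LS2)"
  shows "A \<in> carrier (GL scale)" "B \<in> carrier (GL scale)"
    "S1 \<in> carrier (GL scale)" "S2 \<in> carrier (GL scale)"
    "A \<circ> B \<circ> A = B \<circ> A \<circ> B" "S1 \<circ> S2 \<circ> S1 = S2 \<circ> S1 \<circ> S2"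
    "S1 \<circ> S1 = id" "S2 \<circ> S2 = id"
    "S1 \<circ> S2 \<circ> A = B \<circ> S1 \<circ> S2" "A \<circ> B \<circ> S1 = S2 \<circ> A \<circ> B"
    "\<rho> (loop_elt LS1 \<otimes>\<^bsub>LB3\<^esub> loop_elt LS2) = S1 \<circ> S2"
proof -
  have vs: "vector_space scale" and h: "\<rho> \<in> hom LB3 (GL scale)"
    using assms(1) by (auto simp: group_rep_def)
  interpret GL: group "GL scale" using vs by (rule GL_is_group)
  have carr: "loop_elt g \<in> carrier LB3" for g
    by (simp add: loop_elt_def LB3_def presented_group_def)
  show "A \<in> carrier (GL scale)" "B \<in> carrier (GL scale)"
    "S1 \<in> carrier (GL scale)" "S2 \<in> carrier (GL scale)"
    unfolding A_def B_def S1_def S2_def using h carr by (blast dest: hom_in_carrier)+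
  have eval: "word_eval (GL scale) (\<lambda>g. \<rho> (loop_elt g)) l
      = word_eval (GL scale) (\<lambda>g. \<rho> (loop_elt g)) r"
    if "(l, r) \<in> loop_braid_relations" for l r
    using GL.hom_presented_group_relation[OF h[unfolded LB3_def] that]
    by (simp only: loop_elt_def)
  have rels: "word_eval (GL scale) (\<lambda>g. \<rho> (loop_elt g)) (map letter l)
      = word_eval (GL scale) (\<lambda>g. \<rho> (loop_elt g)) (map letter r)"
    if "(l, r) \<in> {([LSigma1, LSigma2, LSigma1], [LSigma2, LSigma1, LSigma2]),
      ([LS1, LS2, LS1], [LS2, LS1, LS2]), ([LS1, LS1], []), ([LS2, LS2], []),
      ([LS1, LS2, LSigma1], [LSigma2, LS1, LS2]), ([LSigma1, LSigma2, LS1], [LS2, LSigma1, LSigma2])}"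
    for l r
    using that by (intro eval) (auto simp: loop_braid_relations_def)
  show "A \<circ> B \<circ> A = B \<circ> A \<circ> B" "S1 \<circ> S2 \<circ> S1 = S2 \<circ> S1 \<circ> S2"
    "S1 \<circ> S1 = id" "S2 \<circ> S2 = id"
    "S1 \<circ> S2 \<circ> A = B \<circ> S1 \<circ> S2" "A \<circ> B \<circ> S1 = S2 \<circ> A \<circ> B"
    using rels[of "[LSigma1, LSigma2, LSigma1]" "[LSigma2, LSigma1, LSigma2]"]
      rels[of "[LS1, LS2, LS1]" "[LS2, LS1, LS2]"] rels[of "[LS1, LS1]" "[]"]
      rels[of "[LS2, LS2]" "[]"] rels[of "[LS1, LS2, LSigma1]" "[LSigma2, LS1, LS2]"]
      rels[of "[LSigma1, LSigma2, LS1]" "[LS2, LSigma1, LSigma2]"]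
    by (simp_all add: A_def B_def S1_def S2_def comp_assoc)
  show "\<rho> (loop_elt LS1 \<otimes>\<^bsub>LB3\<^esub> loop_elt LS2) = S1 \<circ> S2"
    using hom_mult[OF h carr carr] by (simp add: S1_def S2_def)
qed

text \<open>Converse of \<open>LB3_rep_relations\<close>: by von Dyck's theorem, the six relations
  in \<open>GL\<close> suffice for a representation.\<close>

lemma LB3_rep_exists:
  assumes vs: "vector_space scale"
    and carr: "A \<in> carrier (GL scale)" "B \<in> carrier (GL scale)"
    "S1 \<in> carrier (GL scale)" "S2 \<in> carrier (GL scale)"
    and rels: "A \<circ> B \<circ> A = B \<circ> A \<circ> B" "S1 \<circ> S2 \<circ> S1 = S2 \<circ> S1 \<circ> S2"
    "S1 \<circ> S1 = id" "S2 \<circ> S2 = id"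
    "S1 \<circ> S2 \<circ> A = B \<circ> S1 \<circ> S2" "A \<circ> B \<circ> S1 = S2 \<circ> A \<circ> B"
  obtains \<rho> where "group_rep scale LB3 \<rho>"
    "\<rho> (loop_elt LSigma1) = A" "\<rho> (loop_elt LSigma2) = B"
    "\<rho> (loop_elt LS1) = S1" "\<rho> (loop_elt LS2) = S2"
proof -
  interpret GL: group "GL scale" using vs by (rule GL_is_group)
  define \<phi> where "\<phi> = case_loop_gen A B S1 S2"
  have "range \<phi> \<subseteq> carrier (GL scale)"
    using carr by (auto simp: \<phi>_def split: loop_gen.splits)
  moreover have "word_eval (GL scale) \<phi> l = word_eval (GL scale) \<phi> r"
    if "(l, r) \<in> loop_braid_relations" for l r
    using that rels by (auto simp: loop_braid_relations_def \<phi>_def comp_assoc)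
  ultimately obtain \<rho> where "\<rho> \<in> hom LB3 (GL scale)" "\<And>g. \<rho> (loop_elt g) = \<phi> g"
    unfolding LB3_def loop_elt_def using GL.presented_group_hom_exists by metis
  then show thesis
    using that[of \<rho>] vs by (simp add: group_rep_def \<phi>_def)
qed


context plane begin

text \<open>The condition on \<open>T\<close> is quantified over all bases because it gets used in
  an eigenbasis of \<open>S1\<close>, which is only found inside the proof.\<close>

lemma involution_product:
  assumes S1: "Vector_Spaces.linear scale scale S1" "S1 \<circ> S1 = id"
    and S2: "Vector_Spaces.linear scale scale S2" "S2 \<circ> S2 = id"
    and braid: "S1 \<circ> S2 \<circ> S1 = S2 \<circ> S1 \<circ> S2" and ne: "S1 \<circ> S2 \<noteq> id"
    and T: "\<And>e1 e2. plane scale e1 e2 \<Longrightarrow>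
      \<exists>a b c d. T = plane.op scale e1 e2 a b c d \<and> a + d = -1 \<and> a * d - b * c = 1"
    and conj: "T \<circ> S1 = S2 \<circ> T"
  shows "S1 \<circ> S2 = T"
proof -
  interpret S1: Vector_Spaces.linear scale scale S1 by (rule S1)
  interpret S2: Vector_Spaces.linear scale scale S2 by (rule S2)
  have S1_S1: "S1 (S1 v) = v" and S2_S2: "S2 (S2 v) = v" for v
    using S1(2) S2(2) by (metis comp_apply id_apply)+
  \<comment> \<open>If \<open>S1\<close> were a scalar \<open>k\<close> with square 1, the braid
    relation would make \<open>S2\<close> the same scalar and \<open>S1 \<circ> S2\<close> the
    identity.\<close>
  have nonscalar: "S1 \<noteq> scale k" if "k * k = 1" for k
  proof
    assume k: "S1 = scale k"
    have "S2 v = scale k v" for v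
    proof -
      have "(S1 \<circ> S2 \<circ> S1) v = (S2 \<circ> S1 \<circ> S2) v" by (simp add: braid)
      then show ?thesis using that by (simp add: k S2.scale S2_S2)
    qed
    then have "S1 \<circ> S2 = id" using that by (auto simp: k)
    then show False using ne by contradiction
  qed
  obtain e1' e2' where "plane scale e1' e2'" and S1_op: "S1 = plane.op scale e1' e2' 1 0 0 (-1)"
  proof (rule plane_eigenbasis[OF S1(1), of 1 "-1"])
    show "S1 (S1 v) + scale (1 * - 1) v = scale (1 + - 1) (S1 v)" for v
      by (simp add: S1_S1)
  qed (use nonscalar[of 1] nonscalar[of "-1"] in auto)
  interpret P: plane scale e1' e2' by fact
  obtain a b c d where "T = P.op a b c d" "a + d = -1" "a * d - b * c = 1"
    using T[OF P.plane_axioms] by blast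
  then show ?thesis
    by (rule P.involution_product_op[OF S1_op S2 braid ne _ _ _ conj])
qed

text \<open>Since \<open>S1\<close> is its own inverse, \<open>S2\<close> must be
  \<open>S1 \<circ> S\<close>. That this is again an involution forces the diagonal of
  \<open>S1\<close> to vanish.\<close>

lemma involution_factorization_iff:
  assumes \<omega>: "\<omega>\<^sup>2 + \<omega> + 1 = 0" and S: "S = op \<omega> 0 0 (\<omega>\<^sup>2)"
  shows "S1 \<in> carrier (GL scale) \<and> S2 \<in> carrier (GL scale) \<and>
      S1 \<circ> S1 = id \<and> S2 \<circ> S2 = id \<and> S1 \<circ> S2 = S
    \<longleftrightarrow> (\<exists>b. b \<noteq> 0 \<and> S1 = op 0 b (1 / b) 0 \<and> S2 = op 0 b (1 / b) 0 \<circ> S)"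
    (is "?L \<longleftrightarrow> ?R")
proof
  have cube: "\<omega> * \<omega>\<^sup>2 = 1" using \<omega> by algebra
  {
    assume L: ?L
    have S2: "S2 = S1 \<circ> S" using L by (metis comp_assoc id_comp)
    obtain p q r s where S1: "S1 = op p q r s" using L by (auto elim: linear_eq_op)
    have inv: "p * p + q * r = 1" "r * q + s * s = 1"
      using L by (simp_all add: S1 op_comp id_op op_eq_iff)
    have "(op p q r s \<circ> op \<omega> 0 0 (\<omega>\<^sup>2)) \<circ> (op p q r s \<circ> op \<omega> 0 0 (\<omega>\<^sup>2)) = id"
      using L by (simp add: S2 S1 S)
    then have inv': "p * \<omega> * (p * \<omega>) + q * \<omega>\<^sup>2 * (r * \<omega>) = 1"
      "r * \<omega> * (q * \<omega>\<^sup>2) + s * \<omega>\<^sup>2 * (s * \<omega>\<^sup>2) = 1"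
      unfolding op_comp id_op op_eq_iff by simp_all
    have "\<omega> \<noteq> 1" using \<omega> by auto
    have "\<omega>\<^sup>2 \<noteq> 1"
    proof
      assume "\<omega>\<^sup>2 = 1"
      then show False using cube \<open>\<omega> \<noteq> 1\<close> by simp
    qed
    \<comment> \<open>Diagonal entries of the squares of \<open>S1\<close> and
      \<open>S1 \<circ> S\<close> are compared; the term \<open>q * r\<close> drops out because
      \<omega> cubed is 1.\<close>
    have "p * p * (\<omega>\<^sup>2 - 1) = 0" "s * s * (\<omega> - 1) = 0"
      using inv inv' cube by algebra+
    then have "p = 0" "s = 0" using \<open>\<omega> \<noteq> 1\<close> \<open>\<omega>\<^sup>2 \<noteq> 1\<close> by simp_all
    moreover from this have "q * r = 1" using inv by simp
    then have "q \<noteq> 0" "r = 1 / q" by (auto simp: eq_divide_eq mult.commute)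
    ultimately show ?R using S1 S2 by blast
  }
  assume ?R
  then obtain b where b: "b \<noteq> 0" "S1 = op 0 b (1 / b) 0" "S2 = op 0 b (1 / b) 0 \<circ> S" by blast
  have S2: "S2 = op 0 (b * \<omega>\<^sup>2) (\<omega> / b) 0" by (simp add: b S op_comp)
  have "\<omega> \<noteq> 0" using cube by auto
  then show ?L
    using b(1) cube
    by (simp add: linear_op bij_op_iff S2) (simp add: b(2) S linear_op bij_op_iff op_comp id_op op_eq_iff mult.commute)
qed

text \<open>The fixed line of the antidiagonal involution is X = bY. For nonzero \<open>b\<close>
  these are all lines except the two coordinate axes, which are the eigenspaces of
  \<open>S\<close>.\<close>

lemma line_bij:
  assumes \<omega>: "\<omega> \<noteq> \<mu>" and S: "S = op \<omega> 0 0 \<mu>"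
  shows "bij_betw (\<lambda>b. eigenspace scale (op 0 b (1 / b) 0) 1) {b. b \<noteq> 0}
    (Gr scale 1 - {eigenspace scale S \<omega>, eigenspace scale S \<mu>})"
proof -
  have eig: "eigenspace scale (op 0 b (1 / b) 0) 1 = {v. X v = b * Y v}" if "b \<noteq> 0" for b
    using that by (auto simp: eigenspace_def vec_eq_iff)
  have eig_S: "eigenspace scale S \<omega> = {v. Y v = 0}" "eigenspace scale S \<mu> = {v. X v = 0}"
    using \<omega> by (auto simp: eigenspace_def vec_eq_iff S)
  have "bij_betw (\<lambda>b. {v. X v = b * Y v}) {b. b \<noteq> 0} (Gr scale 1 - {{v. Y v = 0}, {v. X v = 0}})"
  proof (rule bij_betw_imageI)
    show "inj_on (\<lambda>b. {v. X v = b * Y v}) {b. b \<noteq> 0}"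
    proof (rule inj_onI)
      fix b b' assume "{v. X v = b * Y v} = {v. X v = b' * Y v}"
      moreover have "vec b 1 \<in> {v. X v = b * Y v}" by simp
      ultimately have "vec b 1 \<in> {v. X v = b' * Y v}" by simp
      then show "b = b'" by simp
    qed
    show "(\<lambda>b. {v. X v = b * Y v}) ` {b. b \<noteq> 0} = Gr scale 1 - {{v. Y v = 0}, {v. X v = 0}}"
    proof (intro equalityI subsetI)
      fix W assume "W \<in> (\<lambda>b. {v. X v = b * Y v}) ` {b. b \<noteq> 0}"
      then obtain b where b: "b \<noteq> 0" and W: "W = {v. X v = b * Y v}" by blast
      have "W \<in> Gr scale 1"
        unfolding line_iff by (rule exI[of _ b], rule exI[of _ 1]) (simp add: W)
      moreover have "vec b 1 \<in> W" by (simp add: W)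
      ultimately show "W \<in> Gr scale 1 - {{v. Y v = 0}, {v. X v = 0}}"
        using b by auto
    next
      fix W assume W: "W \<in> Gr scale 1 - {{v. Y v = 0}, {v. X v = 0}}"
      then have "W \<in> Gr scale 1" by blast
      then obtain x y where xy: "(x, y) \<noteq> (0, 0)" "W = {v. y * X v = x * Y v}"
        unfolding line_iff by (elim exE conjE)
      have "W = {v. Y v = 0}" if "y = 0" using xy that by auto
      moreover have "W = {v. X v = 0}" if "x = 0" using xy that by auto
      ultimately have "x \<noteq> 0" "y \<noteq> 0" using W by blast+
      then have "y * X v = x * Y v \<longleftrightarrow> X v = x / y * Y v" for v by (simp add: field_simps)
      then have "W = {v. X v = x / y * Y v}" by (simp only: xy(2))
      then show "W \<in> (\<lambda>b. {v. X v = b * Y v}) ` {b. b \<noteq> 0}"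
        using \<open>x \<noteq> 0\<close> \<open>y \<noteq> 0\<close> by (intro image_eqI[of _ _ "x / y"]) auto
    qed
  qed
  then show ?thesis
    unfolding eig_S by (rule bij_betw_cong[THEN iffD1, rotated]) (simp add: eig)
qed

end

text \<open>Every factorization of \<open>S\<close> into two involutions yields an extension: their
  braid relation follows from \<open>cube\<close>, and the mixed relations follow because
  \<open>S\<close> is a nonzero multiple of AB.\<close>

lemma loop_extension_values:
  assumes rep: "group_rep scale B3 \<rho>"
    and S: "S = normalized_product scale (\<rho> (braid_elt Sigma1)) (\<rho> (braid_elt Sigma2))"
    and tr: "lin_trace scale (\<rho> (braid_elt Sigma1) \<circ> \<rho> (braid_elt Sigma2)) \<noteq> 0"
    and cube: "S \<circ> S \<circ> S = id"
  shows "{(\<rho>' (loop_elt LS1), \<rho>' (loop_elt LS2)) |\<rho>'. loop_extension scale \<rho> \<rho>'}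
    = {(S1, S2). S1 \<in> carrier (GL scale) \<and> S2 \<in> carrier (GL scale) \<and>
        S1 \<circ> S1 = id \<and> S2 \<circ> S2 = id \<and> S1 \<circ> S2 = S}" (is "?E = ?F")
proof (intro equalityI subsetI)
  fix p assume "p \<in> ?E"
  then obtain \<rho>' where p: "p = (\<rho>' (loop_elt LS1), \<rho>' (loop_elt LS2))"
    and ext: "loop_extension scale \<rho> \<rho>'" by blast
  then have "group_rep scale LB3 \<rho>'" by (simp add: loop_extension_def)
  from LB3_rep_relations[OF this] ext show "p \<in> ?F"
    by (simp add: p loop_extension_def S)
next
  fix p assume "p \<in> ?F"
  then obtain S1 S2 where p: "p = (S1, S2)" and
    carr: "S1 \<in> carrier (GL scale)" "S2 \<in> carrier (GL scale)" and
    inv: "S1 \<circ> S1 = id" "S2 \<circ> S2 = id" and S12: "S1 \<circ> S2 = S" by blast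
  define A B where AB: "A = \<rho> (braid_elt Sigma1)" "B = \<rho> (braid_elt Sigma2)"
  have vs: "vector_space scale" using rep by (simp add: group_rep_def)
  interpret vector_space scale by (rule vs)
  note A = B3_rep_braid[OF rep, folded AB]
  interpret B: Vector_Spaces.linear scale scale B using A(2) by simp
  interpret S2: Vector_Spaces.linear scale scale S2 using carr(2) by simp
  define k where "k = - inverse (lin_trace scale (A \<circ> B))"
  have k: "k \<noteq> 0" using tr by (simp add: k_def AB)
  have S_k: "S v = scale k (A (B v))" for v
    by (simp add: S normalized_product_def k_def AB)
  have S_k': "A (B v) = scale (inverse k) (S v)" for v
    using k by (simp add: S_k)
  have braid: "A (B (A v)) = B (A (B v))" for v
    using A(3) by (metis comp_apply)
  have "S1 (S2 v) = S v" for v using S12 by (metis comp_apply)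
  moreover have S1_S1: "S1 (S1 v) = v" and S2_S2: "S2 (S2 v) = v" for v
    using inv by (metis comp_apply id_apply)+
  ultimately have S1: "S1 v = S (S2 v)" for v by metis
  have cube': "S (S (S v)) = v" for v using cube by (metis comp_apply id_apply)
  have rel2: "S1 (S2 (S1 v)) = S2 (S1 (S2 v))" for v
  proof -
    \<comment> \<open>\<open>S1 = S \<circ> S2\<close> is an involution, so conjugation by
      \<open>S2\<close> inverts \<open>S\<close>, and the inverse of \<open>S\<close> is its
      square.\<close>
    have "S (S2 (S (S2 w))) = w" for w using S1_S1[of w] by (simp add: S1)
    then have "S2 (S (S2 w)) = S (S w)" for w by (metis cube')
    then have "S (S2 w) = S2 (S (S w))" for w by (metis S2_S2)
    then show ?thesis by (simp add: S1 S2_S2 cube')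
  qed
  obtain \<rho>' where \<rho>': "group_rep scale LB3 \<rho>'"
    "\<rho>' (loop_elt LSigma1) = A" "\<rho>' (loop_elt LSigma2) = B"
    "\<rho>' (loop_elt LS1) = S1" "\<rho>' (loop_elt LS2) = S2"
  proof (rule LB3_rep_exists[OF vs A(1,2) carr A(3) _ inv])
    show "S1 \<circ> S2 \<circ> S1 = S2 \<circ> S1 \<circ> S2" using rel2 by auto
    \<comment> \<open>This is SA = k ABA = k BAB = BS.\<close>
    show "S1 \<circ> S2 \<circ> A = B \<circ> S1 \<circ> S2"
      unfolding S12 comp_assoc by (rule ext) (simp add: S_k braid B.scale)
    \<comment> \<open>Up to the factor \<open>inverse k\<close> both sides are those of the braid
      relation for \<open>S1\<close> and \<open>S2\<close>.\<close>
    show "A \<circ> B \<circ> S1 = S2 \<circ> A \<circ> B"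
    proof
      fix v show "(A \<circ> B \<circ> S1) v = (S2 \<circ> A \<circ> B) v"
        using rel2[of v] by (simp add: S_k' S2.scale S1 S2_S2)
    qed
  qed
  have "\<rho>' (loop_elt LS1 \<otimes>\<^bsub>LB3\<^esub> loop_elt LS2) = S"
    using LB3_rep_relations(11)[OF \<rho>'(1)] by (simp add: \<rho>' S12)
  then have "loop_extension scale \<rho> \<rho>'"
    using \<rho>' by (simp add: loop_extension_def AB S)
  then show "p \<in> ?E" using \<rho>' p by blast
qed

section \<open>The product formula and the classification of extensions\<close>

lemma primitive_cube_root:
  assumes "primitive_root_of_unity 3 \<omega>"
  shows "\<omega>\<^sup>2 + \<omega> + 1 = 0"
proof -
  have "\<omega> ^ 3 = 1" and "\<omega> \<noteq> 1"
    using assms unfolding primitive_root_of_unity_def by (auto dest: spec[of _ 1])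
  moreover have "\<omega> ^ 3 - 1 = (\<omega> - 1) * (\<omega>\<^sup>2 + \<omega> + 1)" by algebra
  ultimately show ?thesis by simp
qed

text \<open>\<open>involution_product\<close> applies with the normalized product as
  \<open>T\<close>, since \<open>normalized_product_op\<close> gives its trace and determinant in
  any basis.\<close>

lemma LB3_rep_product:
  fixes scale :: "complex \<Rightarrow> 'v::ab_group_add \<Rightarrow> 'v"
  assumes dim: "vector_space.dim scale (UNIV :: 'v set) = 2"
    and rep: "group_rep scale LB3 \<rho>"
    and AB: "A = \<rho> (loop_elt LSigma1)" "B = \<rho> (loop_elt LSigma2)" "A \<noteq> B"
  shows "\<rho> (loop_elt LS1 \<otimes>\<^bsub>LB3\<^esub> loop_elt LS2) = normalized_product scale A B"
proof -
  have vs: "vector_space scale" using rep by (simp add: group_rep_def)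
  then obtain e1 e2 where "plane scale e1 e2" using dim by (rule plane_exists)
  interpret plane scale e1 e2 by fact
  define S1 S2 where S12: "S1 = \<rho> (loop_elt LS1)" "S2 = \<rho> (loop_elt LS2)"
  note rels = LB3_rep_relations[OF rep, folded AB(1,2) S12]
  have lin: "Vector_Spaces.linear scale scale A" "bij A" "Vector_Spaces.linear scale scale B" "bij B"
    "Vector_Spaces.linear scale scale S1" "Vector_Spaces.linear scale scale S2"
    using rels(1-4) by simp_all
  interpret S2: Vector_Spaces.linear scale scale S2 by (rule lin)
  \<comment> \<open>Otherwise the relation
    \<open>S1 \<circ> S2 \<circ> A = B \<circ> S1 \<circ> S2\<close> would give A = B.\<close>
  have "S1 \<circ> S2 \<noteq> id" using rels(9) AB(3) by (metis comp_assoc comp_id id_comp)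
  moreover have "\<exists>a b c d. normalized_product scale A B = plane.op scale e1 e2 a b c d
      \<and> a + d = -1 \<and> a * d - b * c = 1" if "plane scale e1 e2" for e1 e2
    using plane.normalized_product_op[OF that lin(1-4) rels(5) AB(3)] by metis
  moreover have "normalized_product scale A B \<circ> S1 = S2 \<circ> normalized_product scale A B"
  proof
    fix v
    have "(A \<circ> B \<circ> S1) v = (S2 \<circ> A \<circ> B) v" by (simp add: rels(10))
    then show "(normalized_product scale A B \<circ> S1) v = (S2 \<circ> normalized_product scale A B) v"
      by (simp add: normalized_product_def S2.scale S2.neg)
  qed
  ultimately have "S1 \<circ> S2 = normalized_product scale A B"
    by (rule involution_product[OF lin(5) rels(7) lin(6) rels(8) rels(6)])
  then show ?thesis by (simp add: rels(11))
qed

text \<open>In an eigenbasis of \<open>S\<close> a nonzero parameter \<open>b\<close> describes both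
  the admissible pairs and the admissible lines. Pairs are collected rather than
  \<open>\<rho>'\<close>, whose values outside the carrier of \<open>LB3\<close> are
  arbitrary.\<close>

lemma loop_extension_bij:
  fixes scale :: "complex \<Rightarrow> 'v::ab_group_add \<Rightarrow> 'v"
  assumes dim: "vector_space.dim scale (UNIV :: 'v set) = 2"
    and rep: "group_rep scale B3 \<rho>"
    and AB: "A = \<rho> (braid_elt Sigma1)" "B = \<rho> (braid_elt Sigma2)" "A \<noteq> B"
    and \<omega>: "\<omega>\<^sup>2 + \<omega> + 1 = 0" and S: "S = normalized_product scale A B"
  shows "\<exists>\<rho>'. loop_extension scale \<rho> \<rho>'"
    and "bij_betw (\<lambda>(S1, S2). eigenspace scale S1 1)
      {(\<rho>' (loop_elt LS1), \<rho>' (loop_elt LS2)) |\<rho>'. loop_extension scale \<rho> \<rho>'}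
      (Gr scale 1 - {eigenspace scale S \<omega>, eigenspace scale S (\<omega>\<^sup>2)})"
proof -
  let ?E = "{(\<rho>' (loop_elt LS1), \<rho>' (loop_elt LS2)) |\<rho>'. loop_extension scale \<rho> \<rho>'}"
  have vs: "vector_space scale" using rep by (simp add: group_rep_def)
  then obtain e1 e2 where "plane scale e1 e2" using dim by (rule plane_exists)
  interpret Q: plane scale e1 e2 by fact
  note rels = B3_rep_braid[OF rep, folded AB(1,2)]
  have lin: "Vector_Spaces.linear scale scale A" "bij A" "Vector_Spaces.linear scale scale B" "bij B"
    using rels(1,2) by simp_all
  obtain a b c d where *: "S = Q.op a b c d" "a + d = -1" "a * d - b * c = 1"
    "lin_trace scale (A \<circ> B) \<noteq> 0"
    using Q.normalized_product_op[OF lin rels(3) AB(3)] S by metis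
  obtain f1 f2 where "plane scale f1 f2" and S_op: "S = plane.op scale f1 f2 \<omega> 0 0 (\<omega>\<^sup>2)"
    using Q.order_3_eigenbasis[OF *(2,3) \<omega>] *(1) by metis
  interpret P: plane scale f1 f2 by fact
  have cube: "\<omega> * \<omega> * \<omega> = 1" and "\<omega>\<^sup>2 * \<omega>\<^sup>2 * \<omega>\<^sup>2 = 1" using \<omega> by algebra+
  then have "S \<circ> S \<circ> S = id" by (simp add: S_op P.op_comp P.id_op P.op_eq_iff)
  then have "?E = {(S1, S2). \<exists>b. b \<noteq> 0 \<and> S1 = P.op 0 b (1 / b) 0 \<and> S2 = P.op 0 b (1 / b) 0 \<circ> S}"
    using loop_extension_values[OF rep, folded AB(1,2), OF S *(4)]
      P.involution_factorization_iff[OF \<omega> S_op] by simp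
  then have E: "?E = (\<lambda>b. (P.op 0 b (1 / b) 0, P.op 0 b (1 / b) 0 \<circ> S)) ` {b. b \<noteq> 0}"
    by auto
  have "?E \<noteq> {}" unfolding E by (auto intro: exI[of _ 1])
  then show "\<exists>\<rho>'. loop_extension scale \<rho> \<rho>'" by blast
  have "\<omega> \<noteq> \<omega>\<^sup>2"
  proof
    assume "\<omega> = \<omega>\<^sup>2"
    then have "(3::complex) = 0" using \<omega> by algebra
    then show False by simp
  qed
  then have bij: "bij_betw (\<lambda>b. eigenspace scale (P.op 0 b (1 / b) 0) 1) {b. b \<noteq> 0}
      (Gr scale 1 - {eigenspace scale S \<omega>, eigenspace scale S (\<omega>\<^sup>2)})"
    using S_op by (rule P.line_bij)
  have "bij_betw (\<lambda>b. (P.op 0 b (1 / b) 0, P.op 0 b (1 / b) 0 \<circ> S)) {b. b \<noteq> 0} ?E"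
    unfolding E by (rule bij_betw_imageI) (auto intro!: inj_onI simp: P.op_eq_iff)
  \<comment> \<open>The parametrization of the pairs followed by the fixed-line map is the bijection
    onto the lines, so the fixed-line map is bijective too.\<close>
  then show "bij_betw (\<lambda>(S1, S2). eigenspace scale S1 1) ?E
      (Gr scale 1 - {eigenspace scale S \<omega>, eigenspace scale S (\<omega>\<^sup>2)})"
    using bij by (simp add: bij_betw_comp_iff comp_def)
qed

text \<open>The witness is exp(2 pi i / 3). It serves the existence of an extension, which is
  claimed without a given \<omega>.\<close>

lemma complex_cube_root_exists: "\<exists>\<omega>::complex. \<omega>\<^sup>2 + \<omega> + 1 = 0"
  by (rule exI[of _ "Complex (-1/2) (sqrt 3 / 2)"])
    (simp add: complex_eq_iff power2_eq_square)

theorem theorem3p1: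
  fixes scale :: "complex \<Rightarrow> 'v::ab_group_add \<Rightarrow> 'v"
  assumes "vector_space scale"
    and "vector_space.dim scale (UNIV :: 'v set) = 2"
  shows "(\<forall>\<rho> A B.
           irreducible_rep scale LB3 \<rho> \<and>
           A = \<rho> (loop_elt LSigma1) \<and> B = \<rho> (loop_elt LSigma2) \<and> A \<noteq> B \<longrightarrow>
             \<rho> (loop_elt LS1 \<otimes>\<^bsub>LB3\<^esub> loop_elt LS2) = normalized_product scale A B) \<and>
         (\<forall>\<rho> A B.
           group_rep scale B3 \<rho> \<and>
           A = \<rho> (braid_elt Sigma1) \<and> B = \<rho> (braid_elt Sigma2) \<and> A \<noteq> B \<longrightarrow>
             (\<exists>\<rho>'. loop_extension scale \<rho> \<rho>') \<and>
             (\<forall>\<omega> S. primitive_root_of_unity 3 \<omega> \<and> S = normalized_product scale A B \<longrightarrow>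
               bij_betw (\<lambda>(S1, S2). eigenspace scale S1 1)
                 {(\<rho>' (loop_elt LS1), \<rho>' (loop_elt LS2)) |\<rho>'. loop_extension scale \<rho> \<rho>'}
                 (Gr scale 1 - {eigenspace scale S \<omega>, eigenspace scale S (\<omega>\<^sup>2)})))"
proof (intro conjI allI impI)
  fix \<rho> A B
  assume "irreducible_rep scale LB3 \<rho> \<and>
    A = \<rho> (loop_elt LSigma1) \<and> B = \<rho> (loop_elt LSigma2) \<and> A \<noteq> B"
  then show "\<rho> (loop_elt LS1 \<otimes>\<^bsub>LB3\<^esub> loop_elt LS2) = normalized_product scale A B"
    using LB3_rep_product[OF assms(2)] by (auto simp: irreducible_rep_def)
next
  fix \<rho> A B
  assume "group_rep scale B3 \<rho> \<and>
    A = \<rho> (braid_elt Sigma1) \<and> B = \<rho> (braid_elt Sigma2) \<and> A \<noteq> B"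
  then show "\<exists>\<rho>'. loop_extension scale \<rho> \<rho>'"
    using loop_extension_bij(1)[OF assms(2)] complex_cube_root_exists by metis
next
  fix \<rho> A B \<omega> S
  assume "group_rep scale B3 \<rho> \<and>
    A = \<rho> (braid_elt Sigma1) \<and> B = \<rho> (braid_elt Sigma2) \<and> A \<noteq> B"
    and "primitive_root_of_unity 3 \<omega> \<and> S = normalized_product scale A B"
  then show "bij_betw (\<lambda>(S1, S2). eigenspace scale S1 1)
      {(\<rho>' (loop_elt LS1), \<rho>' (loop_elt LS2)) |\<rho>'. loop_extension scale \<rho> \<rho>'}
      (Gr scale 1 - {eigenspace scale S \<omega>, eigenspace scale S (\<omega>\<^sup>2)})"
    by (elim conjE) (rule loop_extension_bij(2)[OF assms(2)], auto intro: primitive_cube_root)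
qed

end
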